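(* Let $S=(S_t)_{t\ge 0}$ be a subordinator with Laplace exponent $\phi$ and let $X=(X_t)_{t\ge 0}$ be the corresponding subordinate Brownian motion in $\mathbb{R}^d$ ($d\ge 1$) with transition density $p(t,x,y)=p(t,y-x)$. Then there exist $C>0$ and $\lambda_L\ge 0$ such that $$p(t,x)\le C\,\phi^{-1}(t^{-1})^{d/2}\qquad\text{for all } 0<t<\phi(\lambda_L)^{-1}\text{ and } x\in\mathbb{R}^d$$ if and only if $\phi$ satisfies condition (L).
   Context: A subordinator $S=(S_t)_{t\ge0}$ is an increasing Lévy process with values in $[0,\infty)$, started at $0$. Its Laplace exponent $\phi$ is defined by $\mathbb{E}e^{-\lambda S_t}=e^{-t\phi(\lambda)}$, $\lambda>0$, and $\phi(\lambda)=b\lambda+\int_{(0,\infty)}(1-e^{-\lambda s})\mu(ds)$, where $b\ge0$ is the drift and $\mu$ is the Lévy measure, a measure on $(0,\infty)$ with $\int_{(0,\infty)}(1\wedge s)\mu(ds)<\infty$. The corresponding subordinate Brownian motion is $X_t=B_{S_t}$, where $B$ is a Brownian motion in $\mathbb{R}^d$ independent of $S$, normalized so that $\mathbb{E}e^{i\xi\cdot B_t}=e^{-t|\xi|^2}$; thus $\mathbb{E}_0e^{i\xi\cdot X_t}=e^{-t\phi(|\xi|^2)}$. It is assumed that $X$ has a transition density (equivalently $\mathbb{P}(S_t=0)=0$ for all $t>0$, equivalently $\lim_{\lambda\to\infty}\phi(\lambda)=\infty$), and then $p(t,x)=\int_{(0,\infty)}(4\pi s)^{-d/2}e^{-|x|^2/(4s)}\,\mathbb{P}(S_t\in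 ds)$ for $t>0$, $x\in\mathbb{R}^d$. Condition (L) for a function $f:(0,\infty)\to(0,\infty)$: there exist $\gamma>0$, $\lambda_L\ge0$ and $C_L>0$ such that $f(\lambda x)/f(\lambda)\ge C_Lx^\gamma$ for all $\lambda>\lambda_L$ and $x\ge1$. $\phi^{-1}$ denotes the inverse function of the strictly increasing function $\phi$. Conventions: $\phi(0)=0$ and $0^{-1}=+\infty$. *)

theory Defs
  imports "HOL-Probability.Probability"
begin

text \<open>Processes are functions \<open>real \<Rightarrow> 'w \<Rightarrow> 'b\<close>; only times \<open>t \<ge> 0\<close> are ever constrained or used.\<close>

definition cadlag :: "(real \<Rightarrow> 'b::topological_space) \<Rightarrow> bool" where
  "cadlag f \<longleftrightarrow>
     (\<forall>t\<ge>0. continuous (at_right t) f) \<and> (\<forall>t>0. \<exists>l. (f \<longlongrightarrow> l) (at_left t))"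

definition levy_process ::
    "'w measure \<Rightarrow> (real \<Rightarrow> 'w \<Rightarrow> 'b::euclidean_space) \<Rightarrow> bool" where
  "levy_process M Y \<longleftrightarrow>
     prob_space M \<and>
     (\<forall>t\<ge>0. Y t \<in> borel_measurable M) \<and>
     (\<forall>\<omega>\<in>space M. Y 0 \<omega> = 0 \<and> cadlag (\<lambda>t. Y t \<omega>)) \<and>
     (\<forall>(n::nat) \<tau>. 0 \<le> \<tau> 0 \<and> mono \<tau> \<longrightarrow>
        prob_space.indep_vars M (\<lambda>_. borel)
          (\<lambda>i \<omega>. Y (\<tau> (Suc i)) \<omega> - Y (\<tau> i) \<omega>) {..<n}) \<and>
     (\<forall>s\<ge>0. \<forall>h\<ge>0. distr M borel (\<lambda>\<omega>. Y (s + h) \<omega> - Y s \<omega>) = distr M borel (Y h))"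

definition subordinator :: "'w measure \<Rightarrow> (real \<Rightarrow> 'w \<Rightarrow> real) \<Rightarrow> bool" where
  "subordinator M S \<longleftrightarrow>
     levy_process M S \<and>
     (\<forall>\<omega>\<in>space M. (\<forall>t\<ge>0. 0 \<le> S t \<omega>) \<and> mono_on {0..} (\<lambda>t. S t \<omega>))"

text \<open>The representation of \<open>\<phi>\<close> by a drift and a Levy measure is a consequence of
  this definition (Levy--Khintchine), hence is not part of it. The value at \<open>0\<close> is the
  convention \<open>\<phi>(0) = 0\<close>.\<close>

definition laplace_exponent ::
    "'w measure \<Rightarrow> (real \<Rightarrow> 'w \<Rightarrow> real) \<Rightarrow> (real \<Rightarrow> real) \<Rightarrow> bool" where
  "laplace_exponent M S \<phi> \<longleftrightarrow>
     \<phi> 0 = 0 \<and>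
     (\<forall>lam>0. \<forall>t\<ge>0. (\<integral>\<omega>. exp (- lam * S t \<omega>) \<partial>M) = exp (- t * \<phi> lam))"

text \<open>Each coordinate of \<open>B t\<close> has variance \<open>2 * t\<close>, not \<open>t\<close>.\<close>

definition brownian_motion ::
    "'w measure \<Rightarrow> (real \<Rightarrow> 'w \<Rightarrow> 'b::euclidean_space) \<Rightarrow> bool" where
  "brownian_motion M B \<longleftrightarrow>
     levy_process M B \<and>
     (\<forall>\<omega>\<in>space M. continuous_on {0..} (\<lambda>t. B t \<omega>)) \<and>
     (\<forall>t\<ge>0. \<forall>\<xi>. (\<integral>\<omega>. exp (\<i> * complex_of_real (\<xi> \<bullet> B t \<omega>)) \<partial>M) =
        complex_of_real (exp (- t * (norm \<xi>)\<^sup>2)))"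

text \<open>The sigma-algebra generated by the whole process \<open>(Y t)\<close>, \<open>t \<ge> 0\<close>.\<close>

definition process_algebra ::
    "'w measure \<Rightarrow> (real \<Rightarrow> 'w \<Rightarrow> 'b::topological_space) \<Rightarrow> 'w measure" where
  "process_algebra M Y =
     vimage_algebra (space M) (\<lambda>\<omega>. \<lambda>t\<in>{0..}. Y t \<omega>) (\<Pi>\<^sub>M t\<in>{0..}. borel)"

text \<open>The library's \<^const>\<open>prob_space.indep_var\<close> needs both variables to have the same type,
  so independence of processes with different state spaces is stated for their sigma-algebras.\<close>

definition independent_processes ::
    "'w measure \<Rightarrow> (real \<Rightarrow> 'w \<Rightarrow> 'b::topological_space) \<Rightarrow>
      (real \<Rightarrow> 'w \<Rightarrow> 'c::topological_space) \<Rightarrow> bool" where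
  "independent_processes M Y Z \<longleftrightarrow>
     prob_space.indep_set M (sets (process_algebra M Y)) (sets (process_algebra M Z))"

definition subordinate ::
    "(real \<Rightarrow> 'w \<Rightarrow> 'b) \<Rightarrow> (real \<Rightarrow> 'w \<Rightarrow> real) \<Rightarrow> real \<Rightarrow> 'w \<Rightarrow> 'b" where
  "subordinate B S t \<omega> = B (S t \<omega>) \<omega>"

text \<open>\<open>p t (y - x)\<close> is the density in \<open>y\<close> of the law at time \<open>t\<close> of the process started at \<open>x\<close>.\<close>

definition transition_density ::
    "'w measure \<Rightarrow> (real \<Rightarrow> 'w \<Rightarrow> 'b::euclidean_space) \<Rightarrow> (real \<Rightarrow> 'b \<Rightarrow> ennreal) \<Rightarrow> bool" where
  "transition_density M X p \<longleftrightarrow>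
     (\<forall>t>0. \<forall>x. distributed M lborel (\<lambda>\<omega>. x + X t \<omega>) (\<lambda>y. p t (y - x)))"

text \<open>The integral is taken in the extended nonnegative reals because it can be infinite at
  \<open>x = 0\<close>.\<close>

definition sbm_density ::
    "'w measure \<Rightarrow> (real \<Rightarrow> 'w \<Rightarrow> real) \<Rightarrow> real \<Rightarrow> 'b::euclidean_space \<Rightarrow> ennreal" where
  "sbm_density M S t x =
     (\<integral>\<^sup>+ s\<in>{0<..}.
        ennreal ((4 * pi * s) powr (- real DIM('b) / 2) * exp (- (norm x)\<^sup>2 / (4 * s)))
        \<partial>(distr M borel (S t)))"

definition condition_L :: "(real \<Rightarrow> real) \<Rightarrow> bool" where
  "condition_L f \<longleftrightarrow>
     (\<exists>\<gamma>>0. \<exists>lam\<^sub>L\<ge>0. \<exists>C\<^sub>L>0. \<forall>lam>lam\<^sub>L. \<forall>x\<ge>1. f (lam * x) / f lam \<ge> C\<^sub>L * x powr \<gamma>)"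

end

(* Since the Gaussian kernel is maximal at 0, the bound on p is a bound on the negative moment
   of order a = d / 2 of S t.  Markov's inequality for y powr a * exp (- y) bounds exp (- t * \<phi> lam)
   by that moment; taking t = 1 / \<phi> lam, the upper bound on p forces \<phi> (x * lam) \<ge> 2 * \<phi> lam for
   some fixed x > 1, and iterating this doubling gives (L).  Conversely, a dyadic decomposition
   bounds the negative moment by a series in exp (- t * \<phi> (2 ^ k * r)), which (L) makes converge
   uniformly when r is the value of the inverse of \<phi> at 1 / t.
   The density only enters through P (S t = 0) = 0, which holds because B 0 = 0. *)

theory Submission
  imports Defs
begin

section \<open>Elementary estimates for powers, exponentials and dyadic sums\<close>

text \<open>Raise \<open>y / a <= exp (y / a)\<close> to the power \<open>a\<close>. The constant is
  cruder than the true maximum, but only its independence of \<open>y\<close> matters.\<close>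

lemma powr_times_exp_minus_le:
  fixes a y :: real
  assumes "a > 0" "y > 0"
  shows "y powr a * exp (- y) \<le> a powr a"
proof -
  have "y / a \<le> exp (y / a)"
    using exp_ge_add_one_self[of "y / a"] by linarith
  then have "(y / a) powr a \<le> exp (y / a) powr a"
    using assms by (intro powr_mono2) auto
  also have "\<dots> = exp y"
    using assms by (simp add: powr_def)
  finally have "y powr a \<le> a powr a * exp y"
    using assms by (simp add: powr_divide field_simps)
  then have "y powr a * exp (- y) \<le> (a powr a * exp y) * exp (- y)"
    by (intro mult_right_mono) auto
  then show ?thesis
    by (simp add: mult.assoc flip: exp_add)
qed

lemma power_floor_log:
  fixes b x :: real
  assumes "b > 1" "x \<ge> 1"
  obtains n where "b ^ n \<le> x" "x < b ^ Suc n"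
proof -
  define n where "n = nat \<lfloor>log b x\<rfloor>"
  have n: "real n = of_int \<lfloor>log b x\<rfloor>"
    using assms by (simp add: n_def zero_le_floor)
  have "b powr real n \<le> b powr log b x"
    using assms n by (intro powr_mono) auto
  then have "b ^ n \<le> x"
    using assms by (simp add: powr_realpow)
  moreover have "b powr log b x < b powr real (Suc n)"
    using assms(1)
  proof (rule powr_less_mono[rotated])
    show "log b x < real (Suc n)"
      using n by linarith
  qed
  then have "x < b ^ Suc n"
    using assms by (simp add: powr_realpow del: of_nat_Suc power_Suc)
  ultimately show ?thesis by (rule that)
qed

text \<open>The exponentials stand in for indicators of dyadic blocks, so that integration in
  \<open>s\<close> produces Laplace transforms. If \<open>r * s >= 1\<close>, the summand 1
  suffices. Otherwise \<open>2^k * r * s <= 1 < 2^(k+1) * r * s\<close> for some \<open>k\<close>,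
  and the \<open>k\<close>-th term alone dominates, since there
  \<open>exp 1 * exp (- (2^k * r * s))\<close> is at least 1.\<close>

lemma powr_le_dyadic_suminf:
  fixes a r s :: real
  assumes a: "a > 0" and r: "r > 0" and s: "s > 0"
  shows "ennreal (s powr (- a)) \<le> ennreal (r powr a) *
    (1 + (\<Sum>k. ennreal (exp 1 * 2 powr (a * real (Suc k))) * ennreal (exp (- (2 ^ k * r * s)))))"
    (is "_ \<le> _ * (1 + (\<Sum>k. ?f k))")
proof (cases "r * s \<ge> 1")
  case True
  then have "1 / s \<le> r"
    using s by (simp add: field_simps)
  then have "(1 / s) powr a \<le> r powr a"
    using a s by (intro powr_mono2) auto
  then have "ennreal (s powr (- a)) \<le> ennreal (r powr a) * 1"
    using s by (simp add: powr_divide powr_minus_divide)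
  also have "\<dots> \<le> ennreal (r powr a) * (1 + (\<Sum>k. ?f k))"
    by (intro mult_left_mono) auto
  finally show ?thesis .
next
  case False
  then have "1 / (r * s) \<ge> 1"
    using r s by (simp add: field_simps)
  then obtain k where k: "2 ^ k \<le> 1 / (r * s)" "1 / (r * s) < 2 ^ Suc k"
    using power_floor_log[of 2 "1 / (r * s)"] by auto
  have "1 / s \<le> r * 2 ^ Suc k"
    using k(2) r s by (simp add: field_simps)
  then have "(1 / s) powr a \<le> (r * 2 powr real (Suc k)) powr a"
    using a s by (intro powr_mono2) (auto simp: powr_realpow simp del: of_nat_Suc power_Suc)
  also have "\<dots> = r powr a * 2 powr (a * real (Suc k))"
    using r by (simp add: powr_mult powr_powr mult.commute)
  finally have 1: "s powr (- a) \<le> r powr a * 2 powr (a * real (Suc k))"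
    using s by (simp add: powr_divide powr_minus_divide)
  have "2 ^ k * r * s \<le> 1"
    using k(1) r s by (simp add: field_simps)
  then have "1 \<le> exp 1 * exp (- (2 ^ k * r * s))"
    by (simp flip: exp_add)
  then have "r powr a * 2 powr (a * real (Suc k)) * 1 \<le>
      r powr a * 2 powr (a * real (Suc k)) * (exp 1 * exp (- (2 ^ k * r * s)))"
    by (intro mult_left_mono) auto
  with 1 have "s powr (- a) \<le>
      r powr a * ((exp 1 * 2 powr (a * real (Suc k))) * exp (- (2 ^ k * r * s)))"
    by (simp add: mult_ac)
  then have "ennreal (s powr (- a)) \<le> ennreal (r powr a) * ?f k"
    by (simp add: ennreal_mult'[symmetric] ennreal_leI)
  also have "?f k \<le> (\<Sum>k. ?f k)"
    using sum_le_suminf[of ?f "{k}"] by simp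
  also have "(\<Sum>k. ?f k) \<le> 1 + (\<Sum>k. ?f k)"
    by simp
  finally show ?thesis
    by (simp add: mult_left_mono)
qed

text \<open>The dyadic bound is integrated term by term; the leading 1 is the total mass. Where
  \<open>T\<close> is not positive, the indicator makes the left integrand vanish.\<close>

lemma nn_integral_neg_powr_le:
  fixes a r :: real
  assumes "a > 0" "r > 0" "prob_space M" and [measurable]: "T \<in> borel_measurable M"
  shows "(\<integral>\<^sup>+\<omega>. ennreal (T \<omega> powr (- a)) * indicator {0<..} (T \<omega>) \<partial>M) \<le>
    ennreal (r powr a) * (1 + (\<Sum>k. ennreal (exp 1 * 2 powr (a * real (Suc k))) *
      (\<integral>\<^sup>+\<omega>. ennreal (exp (- (2 ^ k * r * T \<omega>))) \<partial>M)))"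
proof -
  interpret prob_space M by fact
  have "(\<integral>\<^sup>+\<omega>. ennreal (T \<omega> powr (- a)) * indicator {0<..} (T \<omega>) \<partial>M) \<le>
    (\<integral>\<^sup>+\<omega>. ennreal (r powr a) * (1 + (\<Sum>k. ennreal (exp 1 * 2 powr (a * real (Suc k))) *
      ennreal (exp (- (2 ^ k * r * T \<omega>))))) \<partial>M)"
    using powr_le_dyadic_suminf[OF assms(1,2)]
    by (intro nn_integral_mono) (auto split: split_indicator)
  also have "\<dots> = ennreal (r powr a) * (1 + (\<Sum>k. ennreal (exp 1 * 2 powr (a * real (Suc k))) *
      (\<integral>\<^sup>+\<omega>. ennreal (exp (- (2 ^ k * r * T \<omega>))) \<partial>M)))"
    by (simp add: nn_integral_cmult nn_integral_add nn_integral_suminf emeasure_space_1)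
  finally show ?thesis .
qed

text \<open>The exponential decays faster than any power of \<open>2^k\<close>, so it absorbs the
  growth of the coefficients and leaves a geometric series.\<close>

lemma suminf_dyadic_exp_le:
  fixes a c \<gamma> :: real
  assumes a: "a > 0" and c: "c > 0" and \<gamma>: "\<gamma> > 0"
  obtains K where "K > 0"
    "(\<Sum>k. ennreal (exp 1 * 2 powr (a * real (Suc k))) * ennreal (exp (- (c * (2 ^ k) powr \<gamma>)))) \<le>
      ennreal K"
proof
  \<comment> \<open>With \<open>\<gamma> * m = a + 1\<close>, the bound on
    \<open>y powr m * exp (- y)\<close> yields one power of \<open>2^k\<close> more than the
    coefficients consume, hence the ratio 1/2.\<close>
  define m where "m = (a + 1) / \<gamma>"
  define K where "K = exp 1 * 2 powr a * m powr m * c powr (- m)"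
  have m: "m > 0" "\<gamma> * m = a + 1"
    using a \<gamma> by (auto simp: m_def)
  have K: "K > 0"
    using m c by (simp add: K_def)
  then show "2 * K > 0" by simp
  have le: "(exp 1 * 2 powr (a * real (Suc k))) * exp (- (c * (2 ^ k) powr \<gamma>)) \<le> K * (1 / 2) ^ k"
    for k
  proof -
    define e where "e = real k * (a + 1)"
    let ?y = "c * (2 ^ k) powr \<gamma>"
    have "?y powr m = c powr m * 2 powr e"
      using c m by (simp add: powr_mult powr_powr mult.assoc e_def flip: powr_realpow)
    moreover have "?y powr m * exp (- ?y) \<le> m powr m"
      using m c by (intro powr_times_exp_minus_le) auto
    ultimately have "exp (- ?y) \<le> m powr m * c powr (- m) * 2 powr (- e)"
      using c by (simp add: powr_minus field_simps)
    then have "(exp 1 * 2 powr (a * real (Suc k))) * exp (- ?y) \<le>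
        (exp 1 * 2 powr (a * real (Suc k))) * (m powr m * c powr (- m) * 2 powr (- e))"
      by (intro mult_left_mono) auto
    also have "\<dots> = exp 1 * m powr m * c powr (- m) *
        (2 powr (a * real (Suc k)) * 2 powr (- e))"
      by (simp add: mult_ac)
    also have "2 powr (a * real (Suc k)) * 2 powr (- e) = 2 powr (a - k)"
      by (simp add: e_def algebra_simps flip: powr_add)
    also have "2 powr (a - k) = 2 powr a * (1 / 2) ^ k"
      by (simp add: powr_diff powr_realpow power_divide)
    finally show ?thesis
      by (simp add: K_def mult_ac)
  qed
  have "(\<lambda>k. K * (1 / 2) ^ k) sums (K * (1 / (1 - 1 / 2)))"
    by (intro sums_mult geometric_sums) auto
  then have "(\<Sum>k. ennreal (K * (1 / 2) ^ k)) = ennreal (2 * K)"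
    using K by (intro suminf_ennreal_eq) (auto simp: mult.commute)
  moreover have "(\<Sum>k. ennreal (exp 1 * 2 powr (a * real (Suc k))) *
      ennreal (exp (- (c * (2 ^ k) powr \<gamma>)))) \<le> (\<Sum>k. ennreal (K * (1 / 2) ^ k))"
    using le by (intro suminf_le) (auto simp: ennreal_mult'[symmetric] ennreal_leI)
  ultimately show "(\<Sum>k. ennreal (exp 1 * 2 powr (a * real (Suc k))) *
      ennreal (exp (- (c * (2 ^ k) powr \<gamma>)))) \<le> ennreal (2 * K)"
    by simp
qed

text \<open>Each factor \<open>b\<close> in the argument at least doubles the value, so the growth
  exponent is \<open>log b 2\<close>. Rounding \<open>y\<close> down to a power of \<open>b\<close>
  loses at most one doubling, whence the constant 1/2.\<close>

lemma condition_L_if_doubling: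
  fixes f :: "real \<Rightarrow> real"
  assumes mono: "\<And>x y. 0 \<le> x \<Longrightarrow> x \<le> y \<Longrightarrow> f x \<le> f y"
    and pos: "\<And>x. x > 0 \<Longrightarrow> f x > 0"
    and b: "b > 1" and l: "l \<ge> 0"
    and doubling: "\<And>x. x > l \<Longrightarrow> 2 * f x \<le> f (b * x)"
  shows "condition_L f"
proof -
  have pow: "2 ^ n * f x \<le> f (b ^ n * x)" if "x > l" for n x
  proof (induction n)
    case (Suc n)
    have "1 * x \<le> b ^ n * x"
      using b that l by (intro mult_right_mono one_le_power) auto
    with that have "l < b ^ n * x" by simp
    from doubling[OF this] Suc show ?case
      by (simp add: mult.assoc)
  qed simp
  have "f (x * y) / f x \<ge> 1 / 2 * y powr log b 2" if x: "x > l" and y: "y \<ge> 1" for x y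
  proof -
    obtain n where n: "b ^ n \<le> y" "y < b ^ Suc n"
      using power_floor_log[OF b y] .
    have "y powr log b 2 \<le> (b powr real (Suc n)) powr log b 2"
      using n(2) y b
      by (intro powr_mono2) (auto simp: powr_realpow simp del: of_nat_Suc power_Suc)
    also have "\<dots> = (b powr log b 2) powr real (Suc n)"
      by (simp only: powr_powr mult.commute)
    also have "\<dots> = 2 * 2 ^ n"
      using b by (simp add: powr_realpow del: of_nat_Suc)
    finally have "1 / 2 * y powr log b 2 * f x \<le> 2 ^ n * f x"
      using x l pos[of x] by (intro mult_right_mono) auto
    also have "\<dots> \<le> f (b ^ n * x)"
      by (rule pow) fact
    also have "\<dots> \<le> f (x * y)"
      using n(1) x l b by (intro mono) (auto simp: mult.commute intro: mult_left_mono)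
    finally show ?thesis
      using x l pos[of x] by (simp add: field_simps)
  qed
  moreover have "log b 2 > 0"
    using b by simp
  ultimately show ?thesis
    unfolding condition_L_def using l by (intro exI[of _ "log b 2"] conjI exI[of _ l] exI[of _ "1/2"]) auto
qed

section \<open>Laplace transforms of almost surely positive random variables\<close>

text \<open>One time is fixed: \<open>T\<close> stands for \<open>S t\<close> and
  \<open>\<psi>\<close> for \<open>t * \<phi>\<close>. Time 1 gives the regularity of
  \<open>\<phi>\<close>, general times the moment estimates.\<close>

locale laplace_transform = prob_space M for M :: "'w measure" +
  fixes T :: "'w \<Rightarrow> real" and \<psi> :: "real \<Rightarrow> real"
  assumes T_measurable [measurable]: "T \<in> borel_measurable M"
    and T_nonneg: "\<And>\<omega>. \<omega> \<in> space M \<Longrightarrow> 0 \<le> T \<omega>"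
    and T_pos: "AE \<omega> in M. 0 < T \<omega>"
    and laplace: "\<And>l. l \<ge> 0 \<Longrightarrow> (\<integral>\<omega>. exp (- (l * T \<omega>)) \<partial>M) = exp (- \<psi> l)"
begin

lemma exp_integrable: "l \<ge> 0 \<Longrightarrow> integrable M (\<lambda>\<omega>. exp (- (l * T \<omega>)))"
  using T_nonneg by (intro integrable_const_bound[of _ 1]) auto

lemma nn_laplace: "l \<ge> 0 \<Longrightarrow> (\<integral>\<^sup>+\<omega>. ennreal (exp (- (l * T \<omega>))) \<partial>M) = ennreal (exp (- \<psi> l))"
  using nn_integral_eq_integral[OF exp_integrable] laplace by simp

text \<open>Since \<open>T > 0\<close> almost surely, the integrands are strictly ordered almost
  everywhere, and on a space of positive mass the integrals inherit strictness.\<close>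

lemma exponent_strict_mono:
  assumes "0 \<le> l" "l < m"
  shows "\<psi> l < \<psi> m"
proof -
  have "(\<integral>\<omega>. exp (- (m * T \<omega>)) \<partial>M) < (\<integral>\<omega>. exp (- (l * T \<omega>)) \<partial>M)"
  proof (rule integral_less_AE_space)
    show "AE \<omega> in M. exp (- (m * T \<omega>)) < exp (- (l * T \<omega>))"
      using T_pos by eventually_elim (use assms in simp)
  qed (use assms exp_integrable in \<open>auto simp: emeasure_space_1\<close>)
  then show ?thesis
    using assms laplace by simp
qed

text \<open>Dominated convergence with the bound 1, valid since \<open>T\<close> is nonnegative,
  followed by a logarithm.\<close>

lemma exponent_continuous: "continuous_on {0..} \<psi>"
proof -
  have "continuous_on {0..} (\<lambda>l. \<integral>\<omega>. exp (- (l * T \<omega>)) \<partial>M)"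
  proof (rule continuous_on_sequentiallyI)
    fix u :: "nat \<Rightarrow> real" and l :: real
    assume u: "\<forall>n. u n \<in> {0..}" "l \<in> {0..}" "u \<longlonglongrightarrow> l"
    show "(\<lambda>n. \<integral>\<omega>. exp (- (u n * T \<omega>)) \<partial>M) \<longlonglongrightarrow> (\<integral>\<omega>. exp (- (l * T \<omega>)) \<partial>M)"
      by (rule integral_dominated_convergence[where w = "\<lambda>_. 1"])
        (use u T_nonneg in \<open>auto intro!: tendsto_intros AE_I2\<close>)
  qed
  then have "continuous_on {0..} (\<lambda>l. exp (- \<psi> l))"
    by (rule continuous_on_eq) (simp add: laplace)
  then have "continuous_on {0..} (\<lambda>l. ln (exp (- \<psi> l)))"
    by (rule continuous_on_ln) auto
  then show ?thesis
    using continuous_on_minus by fastforce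
qed

text \<open>By dominated convergence the Laplace transform at \<open>n\<close> tends to
  \<open>P(T = 0)\<close>, which is 0.\<close>

lemma exponent_unbounded: "\<exists>l\<ge>0. y \<le> \<psi> l"
proof -
  have "(\<lambda>n. \<integral>\<omega>. exp (- (real n * T \<omega>)) \<partial>M) \<longlonglongrightarrow> (\<integral>\<omega>. 0 \<partial>M)"
  proof (rule integral_dominated_convergence[where w = "\<lambda>_. 1"])
    show "AE \<omega> in M. (\<lambda>n. exp (- (real n * T \<omega>))) \<longlonglongrightarrow> 0"
      using T_pos
    proof eventually_elim
      case (elim \<omega>)
      have "(\<lambda>n. exp (- T \<omega>) ^ n) \<longlonglongrightarrow> 0"
        using elim by (intro LIMSEQ_power_zero) auto
      then show ?case
        by (simp flip: exp_of_nat_mult)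
    qed
  qed (use T_nonneg in \<open>auto intro!: AE_I2\<close>)
  then have "eventually (\<lambda>n. (\<integral>\<omega>. exp (- (real n * T \<omega>)) \<partial>M) < exp (- y)) sequentially"
    by (intro order_tendstoD(2)) auto
  then obtain n where "(\<integral>\<omega>. exp (- (real n * T \<omega>)) \<partial>M) < exp (- y)"
    by (auto simp: eventually_sequentially)
  then show ?thesis
    by (intro exI[of _ "real n"]) (simp add: laplace)
qed

text \<open>Divide \<open>(l * T) powr a * exp (- (l * T)) <= a powr a\<close> by
  \<open>(l * T) powr a\<close>, which is possible off the null set \<open>T = 0\<close>, and
  integrate.\<close>

lemma exp_exponent_le:
  fixes a l :: real
  assumes a: "a > 0" and l: "l > 0"
  shows "ennreal (exp (- \<psi> l)) \<le> ennreal (a powr a * l powr (- a)) *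
    (\<integral>\<^sup>+\<omega>. ennreal (T \<omega> powr (- a)) * indicator {0<..} (T \<omega>) \<partial>M)"
proof -
  have "ennreal (exp (- \<psi> l)) = (\<integral>\<^sup>+\<omega>. ennreal (exp (- (l * T \<omega>))) \<partial>M)"
    using l by (simp add: nn_laplace)
  also have "\<dots> \<le> (\<integral>\<^sup>+\<omega>. ennreal (a powr a * l powr (- a)) *
      (ennreal (T \<omega> powr (- a)) * indicator {0<..} (T \<omega>)) \<partial>M)"
  proof (rule nn_integral_mono_AE)
    show "AE \<omega> in M. ennreal (exp (- (l * T \<omega>))) \<le> ennreal (a powr a * l powr (- a)) *
      (ennreal (T \<omega> powr (- a)) * indicator {0<..} (T \<omega>))"
      using T_pos
    proof eventually_elim
      case (elim \<omega>)
      have "(l * T \<omega>) powr a * exp (- (l * T \<omega>)) \<le> a powr a"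
        using a l elim by (intro powr_times_exp_minus_le) auto
      then have "exp (- (l * T \<omega>)) \<le> a powr a * l powr (- a) * T \<omega> powr (- a)"
        using l elim by (simp add: powr_mult powr_minus field_simps)
      then show ?case
        using elim by (simp add: ennreal_mult'[symmetric] ennreal_leI)
    qed
  qed
  also have "\<dots> = ennreal (a powr a * l powr (- a)) *
      (\<integral>\<^sup>+\<omega>. ennreal (T \<omega> powr (- a)) * indicator {0<..} (T \<omega>) \<partial>M)"
    by (rule nn_integral_cmult) simp
  finally show ?thesis .
qed

end

section \<open>The density at the origin and positivity of the subordinator\<close>

text \<open>At the origin the Gaussian factor is 1 and a power of \<open>4 * pi\<close> splits off;
  this turns bounds on the density into bounds on a negative moment.\<close>

lemma sbm_density_zero:
  assumes [measurable]: "S t \<in> borel_measurable M"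
  shows "sbm_density M S t (0 :: 'b::euclidean_space) =
    ennreal ((4 * pi) powr (- (real DIM('b) / 2))) *
    (\<integral>\<^sup>+\<omega>. ennreal (S t \<omega> powr (- (real DIM('b) / 2))) * indicator {0<..} (S t \<omega>) \<partial>M)"
proof -
  have "sbm_density M S t (0 :: 'b) = (\<integral>\<^sup>+\<omega>.
      ennreal ((4 * pi * S t \<omega>) powr (- real DIM('b) / 2)) * indicator {0<..} (S t \<omega>) \<partial>M)"
    unfolding sbm_density_def by (subst nn_integral_distr) auto
  also have "\<dots> = (\<integral>\<^sup>+\<omega>. ennreal ((4 * pi) powr (- (real DIM('b) / 2))) *
      (ennreal (S t \<omega> powr (- (real DIM('b) / 2))) * indicator {0<..} (S t \<omega>)) \<partial>M)"
    by (intro nn_integral_cong)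
      (auto simp: powr_mult ennreal_mult'[symmetric] split: split_indicator)
  finally show ?thesis
    by (simp add: nn_integral_cmult)
qed

lemma sbm_density_le_zero:
  "sbm_density M S t (x :: 'b::euclidean_space) \<le> sbm_density M S t (0 :: 'b)"
  unfolding sbm_density_def
  by (intro nn_integral_mono) (auto split: split_indicator intro!: ennreal_leI mult_left_le)

text \<open>A law with a density has no atom at 0, whereas \<open>S t = 0\<close> would place the
  subordinate process at \<open>B 0 = 0\<close>.\<close>

lemma AE_pos_if_transition_density:
  assumes "subordinator M S" "brownian_motion M B" "transition_density M (subordinate B S) p" "t > 0"
  shows "AE \<omega> in M. 0 < S t \<omega>"
proof -
  have distr: "distributed M lborel (\<lambda>\<omega>. 0 + subordinate B S t \<omega>) (\<lambda>y. p t (y - 0))"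
    using assms(3,4) unfolding transition_density_def by blast
  have "AE x in distr M lborel (\<lambda>\<omega>. 0 + subordinate B S t \<omega>). x \<noteq> 0"
    unfolding distributed_distr_eq_density[OF distr]
    using AE_lborel_singleton[of 0] distributed_borel_measurable[OF distr]
    by (subst AE_density) auto
  then have "AE \<omega> in M. subordinate B S t \<omega> \<noteq> 0"
    using distributed_measurable[OF distr] by (subst (asm) AE_distr_iff) auto
  moreover have "AE \<omega> in M. 0 \<le> S t \<omega> \<and> B 0 \<omega> = 0"
    using assms by (intro AE_I2) (auto simp: subordinator_def brownian_motion_def levy_process_def)
  ultimately show ?thesis
    by eventually_elim (auto simp: subordinate_def less_le)
qed

section \<open>Equivalence of the density bound and condition (L)\<close>

theorem theorem1p1:
  fixes M :: "'w measure"
    and S :: "real \<Rightarrow> 'w \<Rightarrow> real"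
    and B :: "real \<Rightarrow> 'w \<Rightarrow> real ^ 'd"
    and \<phi> :: "real \<Rightarrow> real"
    and p :: "real \<Rightarrow> real ^ 'd \<Rightarrow> ennreal"
  assumes "subordinator M S"
    and "laplace_exponent M S \<phi>"
    and "brownian_motion M B"
    and "independent_processes M B S"
    and "transition_density M (subordinate B S) p"
    and "\<And>t x. t > 0 \<Longrightarrow> p t x = sbm_density M S t x"
  shows "(\<exists>C>0. \<exists>lam\<^sub>L\<ge>0. \<forall>t x. 0 < t \<and> ennreal t < inverse (ennreal (\<phi> lam\<^sub>L)) \<longrightarrow>
            p t x \<le> ennreal (C * inv_into {0..} \<phi> (inverse t) powr (real CARD('d) / 2)))
         \<longleftrightarrow> condition_L \<phi>"
proof -
  define a where "a = real CARD('d) / 2"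
  define c where "c = (4 * pi) powr (- a)"
  define I where "I t = (\<integral>\<^sup>+\<omega>. ennreal (S t \<omega> powr (- a)) * indicator {0<..} (S t \<omega>) \<partial>M)" for t
  have a: "a > 0" and c: "c > 0"
    by (auto simp: a_def c_def)
  have M: "prob_space M" and S_meas: "\<And>t. t \<ge> 0 \<Longrightarrow> S t \<in> borel_measurable M"
    using assms(1) by (auto simp: subordinator_def levy_process_def)
  have phi0: "\<phi> 0 = 0"
    using assms(2) by (simp add: laplace_exponent_def)
  have laplace: "laplace_transform M (S t) (\<lambda>l. t * \<phi> l)" if "t > 0" for t
  proof -
    interpret prob_space M by fact
    show ?thesis
    proof
      show "AE \<omega> in M. 0 < S t \<omega>"
        using AE_pos_if_transition_density assms(1,3,5) that by blast
      \<comment> \<open>The Laplace exponent is prescribed only for positive arguments; at 0 the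
        identity says that the total mass is 1, by \<open>\<phi> 0 = 0\<close>.\<close>
      show "(\<integral>\<omega>. exp (- (l * S t \<omega>)) \<partial>M) = exp (- (t * \<phi> l))" if "l \<ge> 0" for l
        using assms(2) \<open>t > 0\<close> that
        by (cases "l = 0") (auto simp: laplace_exponent_def prob_space)
    qed (use assms(1) that in \<open>auto simp: subordinator_def levy_process_def\<close>)
  qed
  interpret S1: laplace_transform M "S 1" \<phi>
    using laplace[of 1] by simp
  have phi_pos: "\<phi> l > 0" if "l > 0" for l
    using S1.exponent_strict_mono[of 0 l] that phi0 by simp
  have phi_mono: "\<phi> x \<le> \<phi> y" if "0 \<le> x" "x \<le> y" for x y
    using S1.exponent_strict_mono[of x y] that by (cases "x = y") auto
  have phi_less_iff: "\<phi> x < \<phi> y \<longleftrightarrow> x < y" if "0 \<le> x" "0 \<le> y" for x y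
    using S1.exponent_strict_mono[of x y] phi_mono[of y x] that by (auto simp: not_less[symmetric])
  have inj: "inj_on \<phi> {0..}"
    by (rule inj_onI) (metis atLeast_iff less_irrefl linorder_neqE phi_less_iff)
  have inv_phi: "inv_into {0..} \<phi> (\<phi> l) = l" if "l \<ge> 0" for l
    using inj that by simp
  \<comment> \<open>Unboundedness and the intermediate value theorem make \<open>\<phi>\<close> onto
    the half-line, so \<open>inv_into {0..} \<phi>\<close> is a genuine inverse there.\<close>
  have range: "\<exists>l\<ge>0. \<phi> l = y" if "y \<ge> 0" for y
  proof -
    obtain u where u: "u \<ge> 0" "y \<le> \<phi> u"
      using S1.exponent_unbounded by blast
    have "continuous_on {0..u} \<phi>"
      by (rule continuous_on_subset[OF S1.exponent_continuous]) auto
    with IVT'[of \<phi> 0 y u] u that phi0 show ?thesis by auto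
  qed
  \<comment> \<open>For \<open>l = 0\<close> the inverse in \<open>ennreal\<close> is infinite, so
    \<open>t\<close> is unrestricted; this matches \<open>t * 0 < 1\<close>.\<close>
  have less_inverse: "ennreal t < inverse (ennreal (\<phi> l)) \<longleftrightarrow> t * \<phi> l < 1" if "t > 0" "l \<ge> 0" for t l
  proof (cases "l = 0")
    case True
    then show ?thesis by (simp add: phi0)
  next
    case False
    with that have "\<phi> l > 0" using phi_pos by simp
    with that show ?thesis
      by (simp add: inverse_ennreal ennreal_less_iff field_simps)
  qed
  have p0: "p t 0 = ennreal c * I t" and p_le: "p t x \<le> ennreal c * I t" if "t > 0" for t x
    using sbm_density_zero[where S = S and M = M and t = t and 'b = "real ^ 'd", OF S_meas]
      sbm_density_le_zero[of M S t x] that assms(6)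
    by (simp_all add: I_def a_def c_def)
  show ?thesis
  proof
    assume "\<exists>C>0. \<exists>lam\<^sub>L\<ge>0. \<forall>t x. 0 < t \<and> ennreal t < inverse (ennreal (\<phi> lam\<^sub>L)) \<longrightarrow>
      p t x \<le> ennreal (C * inv_into {0..} \<phi> (inverse t) powr (real CARD('d) / 2))"
    then obtain C L where C: "C > 0" and L: "L \<ge> 0" and
      bound: "\<And>t x. 0 < t \<Longrightarrow> ennreal t < inverse (ennreal (\<phi> L)) \<Longrightarrow>
        p t x \<le> ennreal (C * inv_into {0..} \<phi> (inverse t) powr a)"
      unfolding a_def by blast
    define K where "K = a powr a * C / c"
    \<comment> \<open>Chosen so that \<open>K * b powr (- a) <= exp (- 2)\<close>, whose exponent 2
      becomes the doubling factor; the added 1 ensures \<open>b > 1\<close>.\<close>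
    define b where "b = (K * exp 2) powr (1 / a) + 1"
    have K: "K > 0"
      using a C c by (simp add: K_def)
    have b: "b > 1"
      using K by (simp add: b_def)
    have "K * exp 2 = ((K * exp 2) powr (1 / a)) powr a"
      using a K by (simp add: powr_powr)
    also have "\<dots> \<le> b powr a"
      using a by (intro powr_mono2) (auto simp: b_def)
    finally have b_ge: "K * b powr (- a) \<le> exp (- 2)"
      using b by (simp add: powr_minus exp_minus field_simps)
    have "2 * \<phi> l \<le> \<phi> (b * l)" if l: "l > L" for l
    proof -
      have pos: "l > 0" "\<phi> l > 0"
        using l L phi_pos by auto
      \<comment> \<open>At this time the inverse of \<open>\<phi>\<close> at \<open>1 / t\<close> is
        \<open>l\<close> itself, and \<open>l > L\<close> makes the time admissible. The assumed
        bound is then applied at \<open>x = 0\<close> only.\<close>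
      define t where "t = 1 / \<phi> l"
      have t: "t > 0" "inverse t = \<phi> l"
        using pos by (auto simp: t_def)
      have "t * \<phi> L < 1"
        using phi_less_iff[of L l] L l pos by (simp add: t_def)
      with bound[of t 0] t L pos have le: "ennreal c * I t \<le> ennreal (C * l powr a)"
        by (simp add: less_inverse p0 inv_phi)
      interpret St: laplace_transform M "S t" "\<lambda>l. t * \<phi> l"
        by (rule laplace) fact
      \<comment> \<open>Testing at \<open>b * l\<close> rather than \<open>l\<close> lets the powers
        of \<open>l\<close> cancel against the assumed bound, so that only
        \<open>K * b powr (- a)\<close> remains.\<close>
      have "ennreal (exp (- (t * \<phi> (b * l)))) \<le> ennreal (a powr a * (b * l) powr (- a)) * I t"
        unfolding I_def using a b pos by (intro St.exp_exponent_le) auto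
      also have "\<dots> = ennreal (a powr a * (b * l) powr (- a) / c) * (ennreal c * I t)"
        using c by (simp add: ennreal_mult'[symmetric] flip: mult.assoc)
      also have "\<dots> \<le> ennreal (a powr a * (b * l) powr (- a) / c) * ennreal (C * l powr a)"
        using le by (rule mult_left_mono) simp
      also have "\<dots> = ennreal (K * b powr (- a))"
        using b pos c C by (simp add: ennreal_mult'[symmetric] K_def powr_mult powr_minus field_simps)
      finally have "exp (- (t * \<phi> (b * l))) \<le> K * b powr (- a)"
        using K by (simp add: ennreal_le_iff)
      also note b_ge
      finally have "2 \<le> t * \<phi> (b * l)" by simp
      then show ?thesis
        using pos by (simp add: t_def field_simps)
    qed
    then show "condition_L \<phi>"
      using phi_mono phi_pos b L by (intro condition_L_if_doubling)
  next
    assume "condition_L \<phi>"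
    then obtain \<gamma> L C where \<gamma>: "\<gamma> > 0" and L: "L \<ge> 0" and C: "C > 0" and
      growth: "\<And>l x. l > L \<Longrightarrow> x \<ge> 1 \<Longrightarrow> \<phi> (l * x) / \<phi> l \<ge> C * x powr \<gamma>"
      unfolding condition_L_def by blast
    obtain K where K: "K > 0" and
      sum_le: "(\<Sum>k. ennreal (exp 1 * 2 powr (a * real (Suc k))) *
        ennreal (exp (- (C * (2 ^ k) powr \<gamma>)))) \<le> ennreal K"
      using suminf_dyadic_exp_le[OF a C \<gamma>] .
    have "p t x \<le> ennreal (c * (1 + K) * inv_into {0..} \<phi> (inverse t) powr a)"
      if t: "t > 0" "ennreal t < inverse (ennreal (\<phi> L))" for t x
    proof -
      \<comment> \<open>\<open>r\<close> is the inverse of \<open>\<phi>\<close> at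
        \<open>1 / t\<close>; the restriction on \<open>t\<close> says exactly that
        \<open>r > L\<close>, so (L) is available at \<open>r\<close>.\<close>
      obtain r where r: "r \<ge> 0" "\<phi> r = inverse t"
        using range[of "inverse t"] t(1) by auto
      have "\<phi> L < \<phi> r"
        using t L by (simp add: less_inverse r(2) field_simps)
      with phi_less_iff[of L r] L r have rL: "r > L" "r > 0" by auto
      interpret St: laplace_transform M "S t" "\<lambda>l. t * \<phi> l"
        by (rule laplace) fact
      \<comment> \<open>Since \<open>t = 1 / \<phi> r\<close>, the exponent is the ratio
        \<open>\<phi> (2^k * r) / \<phi> r\<close>, which (L) bounds below independently of
        \<open>t\<close>.\<close>
      have exp_le: "exp (- (t * \<phi> (2 ^ k * r))) \<le> exp (- (C * (2 ^ k) powr \<gamma>))" for k :: nat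
        using growth[OF rL(1), of "2 ^ k"] r(2) t(1) by (simp add: field_simps)
      have "I t \<le> ennreal (r powr a) * (1 + (\<Sum>k. ennreal (exp 1 * 2 powr (a * real (Suc k))) *
        (\<integral>\<^sup>+\<omega>. ennreal (exp (- (2 ^ k * r * S t \<omega>))) \<partial>M)))"
        unfolding I_def using a rL(2) M S_meas t(1) by (intro nn_integral_neg_powr_le) auto
      also have "\<dots> = ennreal (r powr a) * (1 + (\<Sum>k. ennreal (exp 1 * 2 powr (a * real (Suc k))) *
        ennreal (exp (- (t * \<phi> (2 ^ k * r))))))"
        using r(1) by (simp add: St.nn_laplace)
      also have "\<dots> \<le> ennreal (r powr a) * (1 + (\<Sum>k. ennreal (exp 1 * 2 powr (a * real (Suc k))) *
        ennreal (exp (- (C * (2 ^ k) powr \<gamma>)))))"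
        by (intro mult_left_mono add_left_mono suminf_le ennreal_leI exp_le) auto
      also have "\<dots> \<le> ennreal (r powr a) * (1 + ennreal K)"
        by (intro mult_left_mono add_left_mono sum_le) auto
      also have "\<dots> = ennreal ((1 + K) * r powr a)"
        using K by (simp add: ennreal_mult'[symmetric] mult.commute flip: ennreal_1 ennreal_plus)
      finally have "ennreal c * I t \<le> ennreal c * ennreal ((1 + K) * r powr a)"
        by (rule mult_left_mono) simp
      with p_le[OF t(1), of x] have "p t x \<le> ennreal c * ennreal ((1 + K) * r powr a)"
        by (rule order_trans)
      also have "\<dots> = ennreal (c * (1 + K) * r powr a)"
        using c K by (simp add: ennreal_mult'[symmetric] mult.assoc)
      finally show ?thesis
        using inv_phi[of r] r by simp
    qed
    moreover have "c * (1 + K) > 0"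
      using c K by simp
    ultimately show "\<exists>C>0. \<exists>lam\<^sub>L\<ge>0. \<forall>t x. 0 < t \<and> ennreal t < inverse (ennreal (\<phi> lam\<^sub>L)) \<longrightarrow>
      p t x \<le> ennreal (C * inv_into {0..} \<phi> (inverse t) powr (real CARD('d) / 2))"
      using L unfolding a_def by blast
  qed
qed

end
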